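(* Let $p$ and $q$ be positive integers with $p<q$, and let $\varepsilon>0$. Then for all sufficiently large $n$ there is a $(q,p)$-coloring $\varphi$ of $K_n$ such that for every monochromatic subgraph $G$ of $K_n$ (with respect to $\varphi$) there is no vertex subset $U\subseteq V(G)$ with $|U|\ge \varepsilon n$ such that among any $q$ vertices of $U$ there are $p+1$ vertices having at least $\varepsilon n$ common neighbors in $G$.
   Context: A $(q,p)$-coloring of the complete graph $K_n$ is an assignment $\varphi$ to each edge $e$ of $K_n$ of a set $\varphi(e)$ of exactly $p$ colors from a fixed palette of $q$ colors. A subgraph $H$ of $K_n$ is monochromatic (with respect to $\varphi$) if $\bigcap_{e\in E(H)}\varphi(e)\neq\varnothing$. *)

theory Defs
  imports Complex_Main "HOL-Library.Ramsey"
begin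

text \<open>A simple graph is a pair of a vertex set and a set of two-element subsets of it;
  \<open>[V]\<^bsup>2\<^esup>\<close> is the set of all two-element subsets of \<open>V\<close>.\<close>

type_synonym 'a graph = "'a set \<times> 'a set set"

definition verts :: "'a graph \<Rightarrow> 'a set" where
  "verts G = fst G"

definition edges :: "'a graph \<Rightarrow> 'a set set" where
  "edges G = snd G"

definition simple_graph :: "'a graph \<Rightarrow> bool" where
  "simple_graph G \<longleftrightarrow> edges G \<subseteq> [verts G]\<^bsup>2\<^esup>"

definition is_subgraph :: "'a graph \<Rightarrow> 'a graph \<Rightarrow> bool" where
  "is_subgraph H G \<longleftrightarrow> simple_graph H \<and> verts H \<subseteq> verts G \<and> edges H \<subseteq> edges G"

definition complete_graph :: "nat \<Rightarrow> nat graph" where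
  "complete_graph n = ({..<n}, [{..<n}]\<^bsup>2\<^esup>)"

definition common_neighbors :: "'a graph \<Rightarrow> 'a set \<Rightarrow> 'a set" where
  "common_neighbors G T = {v \<in> verts G. \<forall>t\<in>T. {t, v} \<in> edges G}"

text \<open>The palette is \<open>{..<q}\<close>. The values of \<open>\<phi>\<close> on sets that are not edges
  are irrelevant.\<close>

definition set_coloring :: "nat \<Rightarrow> nat \<Rightarrow> 'a graph \<Rightarrow> ('a set \<Rightarrow> nat set) \<Rightarrow> bool" where
  "set_coloring q p G \<phi> \<longleftrightarrow> (\<forall>e\<in>edges G. \<phi> e \<subseteq> {..<q} \<and> card (\<phi> e) = p)"

text \<open>The empty intersection is \<open>UNIV\<close>, so edgeless graphs count as monochromatic.\<close>

definition monochromatic_graph :: "('a set \<Rightarrow> nat set) \<Rightarrow> 'a graph \<Rightarrow> bool" where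
  "monochromatic_graph \<phi> H \<longleftrightarrow> (\<Inter>e\<in>edges H. \<phi> e) \<noteq> {}"

end

theory Submission
  imports Defs "HOL-Number_Theory.Cong"
begin

text \<open>
  Blow up the vertex set $\{0,\dots,q-1\}^d \times \{0,\dots,d-1\}$, where $d$ depends only on
  $q$ and $\varepsilon$. The pair $(x,s)$, $(z,t)$ receives the base colour $x_j + z_j$ modulo $q$
  with $j = s + t$ modulo $d$, and its colour set is the cyclic interval of length $p$ starting there.

  A dense $U$ is dense on some slice with $s$ fixed. By concentration of measure, almost every
  point is within Hamming distance $o(d)$ of a dense set $A$; applied to the $q$ translates of
  $A$ by constant vectors, this gives $x_0,\dots,x_{q-1} \in A$ that take $q$ distinct values in
  all but $o(d)$ coordinates. For fixed $s$ and random $(z,t)$ the coordinate $j$ is uniform, so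
  almost every $(z,t)$ sees $q$ distinct base colours on the pairs with the $(x_i,s)$. Each colour
  lies in only $p$ cyclic intervals, so no such vertex is a common neighbour of $p+1$ of them.
\<close>

section \<open>Variance of Lipschitz functions on product spaces\<close>

lemma sum_PiE_insert:
  fixes f :: "('i \<Rightarrow> 'b) \<Rightarrow> 'c::comm_monoid_add"
  assumes "i \<notin> I"
  shows "(\<Sum>x\<in>insert i I \<rightarrow>\<^sub>E B. f x) = (\<Sum>x\<in>I \<rightarrow>\<^sub>E B. \<Sum>b\<in>B. f (x(i := b)))"
proof -
  have "(\<Sum>x\<in>insert i I \<rightarrow>\<^sub>E B. f x) = (\<Sum>(b, x)\<in>B \<times> (I \<rightarrow>\<^sub>E B). f (x(i := b)))"
    unfolding PiE_insert_eq
    by (subst sum.reindex[OF inj_combinator[OF assms]]) (simp add: case_prod_unfold)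
  also have "\<dots> = (\<Sum>b\<in>B. \<Sum>x\<in>I \<rightarrow>\<^sub>E B. f (x(i := b)))"
    by (simp add: sum.cartesian_product)
  also have "\<dots> = (\<Sum>x\<in>I \<rightarrow>\<^sub>E B. \<Sum>b\<in>B. f (x(i := b)))"
    by (rule sum.swap)
  finally show ?thesis .
qed

text \<open>Both sides are 2 |P|^2 times the variance of \<open>g\<close> under the uniform measure
  on \<open>P\<close>. This scaling avoids division, and the double sum can later be bounded below
  by keeping only some of the pairs.\<close>

lemma sum_sum_diff_squared:
  fixes g :: "'a \<Rightarrow> real"
  shows "(\<Sum>x\<in>P. \<Sum>y\<in>P. (g x - g y)\<^sup>2) = 2 * (real (card P) * (\<Sum>x\<in>P. (g x)\<^sup>2) - (\<Sum>x\<in>P. g x)\<^sup>2)"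
proof -
  have "(\<Sum>x\<in>P. \<Sum>y\<in>P. (g x - g y)\<^sup>2)
      = (\<Sum>x\<in>P. \<Sum>y\<in>P. (g x)\<^sup>2) + (\<Sum>x\<in>P. \<Sum>y\<in>P. (g y)\<^sup>2) - 2 * (\<Sum>x\<in>P. \<Sum>y\<in>P. g x * g y)"
    by (simp add: power2_diff sum.distrib sum_subtractf sum_distrib_left algebra_simps)
  also have "(\<Sum>x\<in>P. \<Sum>y\<in>P. g x * g y) = (\<Sum>x\<in>P. g x)\<^sup>2"
    by (simp add: sum_product power2_eq_square)
  finally show ?thesis
    by (simp add: sum_distrib_left)
qed

text \<open>In the pairwise form of the variance each of the |P|^2 terms is at most L^2. The factor
  2 that this would gain is given away.\<close>

lemma variance_le_diameter:
  fixes g :: "'a \<Rightarrow> real"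
  assumes "\<And>x y. x \<in> P \<Longrightarrow> y \<in> P \<Longrightarrow> \<bar>g x - g y\<bar> \<le> L"
  shows "real (card P) * (\<Sum>x\<in>P. (g x)\<^sup>2) - (\<Sum>x\<in>P. g x)\<^sup>2 \<le> L\<^sup>2 * (real (card P))\<^sup>2"
proof -
  have "(g x - g y)\<^sup>2 \<le> L\<^sup>2" if "x \<in> P" "y \<in> P" for x y
    using power_mono[OF assms[OF that], of 2] by simp
  then have "(\<Sum>x\<in>P. \<Sum>y\<in>P. (g x - g y)\<^sup>2) \<le> (\<Sum>x\<in>P. \<Sum>y\<in>P. L\<^sup>2)"
    by (intro sum_mono)
  also have "\<dots> = L\<^sup>2 * (real (card P))\<^sup>2"
    by (simp add: power2_eq_square)
  finally have "2 * (real (card P) * (\<Sum>x\<in>P. (g x)\<^sup>2) - (\<Sum>x\<in>P. g x)\<^sup>2) \<le> L\<^sup>2 * (real (card P))\<^sup>2"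
    unfolding sum_sum_diff_squared .
  moreover have "0 \<le> L\<^sup>2 * (real (card P))\<^sup>2"
    by simp
  moreover have "a \<le> b" if "2 * a \<le> b" "0 \<le> b" for a b :: real
    using that by linarith
  ultimately show ?thesis
    by blast
qed

text \<open>Tensorization: the variance on a product is at most the expected variance in the new
  coordinate plus the variance of the average over that coordinate, which is again Lipschitz.\<close>

lemma variance_PiE_Lipschitz:
  fixes g :: "('i \<Rightarrow> 'b) \<Rightarrow> real"
  assumes "finite I" "finite B"
    and "\<And>i x b. i \<in> I \<Longrightarrow> x \<in> I \<rightarrow>\<^sub>E B \<Longrightarrow> b \<in> B \<Longrightarrow> \<bar>g (x(i := b)) - g x\<bar> \<le> L"
  shows "real (card (I \<rightarrow>\<^sub>E B)) * (\<Sum>x\<in>I \<rightarrow>\<^sub>E B. (g x)\<^sup>2) - (\<Sum>x\<in>I \<rightarrow>\<^sub>E B. g x)\<^sup>2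
      \<le> L\<^sup>2 * real (card I) * (real (card (I \<rightarrow>\<^sub>E B)))\<^sup>2"
  using assms(1,3)
proof (induction I arbitrary: g L rule: finite_induct)
  case empty
  then show ?case by simp
next
  case (insert i I)
  define P where "P = I \<rightarrow>\<^sub>E B"
  define M where "M = real (card P)"
  define Q where "Q = real (card B)"
  \<comment> \<open>A sum over the fibre in place of an average, again to avoid division; the price
    is the Lipschitz constant \<open>Q * L\<close> in place of \<open>L\<close>.\<close>
  define h where "h x = (\<Sum>b\<in>B. g (x(i := b)))" for x
  have card: "real (card (insert i I \<rightarrow>\<^sub>E B)) = Q * M"
    using insert.hyps by (simp add: M_def Q_def P_def card_PiE)
  have upd: "x(i := b) \<in> insert i I \<rightarrow>\<^sub>E B" if "x \<in> P" "b \<in> B" for x b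
    using that unfolding P_def by (auto simp: PiE_insert_eq image_iff)
  have lip: "\<bar>h (x(j := b)) - h x\<bar> \<le> Q * L" if "j \<in> I" "x \<in> P" "b \<in> B" for j x b
  proof -
    have "j \<noteq> i"
      using that insert.hyps by auto
    then have "\<bar>h (x(j := b)) - h x\<bar> \<le> (\<Sum>c\<in>B. \<bar>g ((x(i := c))(j := b)) - g (x(i := c))\<bar>)"
      unfolding h_def sum_subtractf[symmetric] by (simp add: fun_upd_twist sum_abs)
    also have "\<dots> \<le> (\<Sum>c\<in>B. L)"
      using that by (intro sum_mono insert.prems upd) auto
    finally show ?thesis
      by (simp add: Q_def)
  qed
  have IH: "M * (\<Sum>x\<in>P. (h x)\<^sup>2) - (\<Sum>x\<in>P. h x)\<^sup>2 \<le> (Q * L)\<^sup>2 * real (card I) * M\<^sup>2"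
    unfolding M_def P_def by (rule insert.IH[OF lip[unfolded P_def]])
  have fibre: "Q * (\<Sum>b\<in>B. (g (x(i := b)))\<^sup>2) - (h x)\<^sup>2 \<le> L\<^sup>2 * Q\<^sup>2" if "x \<in> P" for x
    unfolding h_def Q_def
  proof (rule variance_le_diameter)
    fix b c assume "b \<in> B" "c \<in> B"
    then show "\<bar>g (x(i := b)) - g (x(i := c))\<bar> \<le> L"
      using insert.prems[OF insertI1 upd[OF that \<open>c \<in> B\<close>] \<open>b \<in> B\<close>] by (simp only: fun_upd_upd)
  qed
  \<comment> \<open>The law of total variance, scaled by (Q M)^2: the variances inside the fibres
    plus the variance of the fibre sums.\<close>
  have "real (card (insert i I \<rightarrow>\<^sub>E B)) * (\<Sum>x\<in>insert i I \<rightarrow>\<^sub>E B. (g x)\<^sup>2) - (\<Sum>x\<in>insert i I \<rightarrow>\<^sub>E B. g x)\<^sup>2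
      = M * (\<Sum>x\<in>P. Q * (\<Sum>b\<in>B. (g (x(i := b)))\<^sup>2) - (h x)\<^sup>2)
        + (M * (\<Sum>x\<in>P. (h x)\<^sup>2) - (\<Sum>x\<in>P. h x)\<^sup>2)"
    unfolding card sum_PiE_insert[OF insert.hyps(2)] h_def[symmetric] P_def[symmetric]
    by (simp add: sum_subtractf sum_distrib_left[symmetric] algebra_simps)
  also have "\<dots> \<le> M * (\<Sum>x\<in>P. L\<^sup>2 * Q\<^sup>2) + (Q * L)\<^sup>2 * real (card I) * M\<^sup>2"
    by (intro add_mono mult_left_mono sum_mono fibre IH) (simp_all add: M_def)
  also have "\<dots> = L\<^sup>2 * real (card (insert i I)) * (Q * M)\<^sup>2"
    using insert.hyps by (simp add: M_def power2_eq_square algebra_simps)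
  finally show ?case
    unfolding card .
qed

section \<open>Concentration around dense sets in the Hamming distance\<close>

definition hamming :: "'i set \<Rightarrow> ('i \<Rightarrow> 'b) \<Rightarrow> ('i \<Rightarrow> 'b) \<Rightarrow> nat" where
  "hamming I x y = card {i \<in> I. x i \<noteq> y i}"

lemma hamming_fun_upd_le:
  assumes "finite I"
  shows "hamming I (x(i := b)) y \<le> hamming I x y + 1"
proof -
  have "hamming I (x(i := b)) y \<le> card (insert i {j \<in> I. x j \<noteq> y j})"
    unfolding hamming_def using assms by (intro card_mono) auto
  also have "\<dots> \<le> hamming I x y + 1"
    unfolding hamming_def using assms by (simp add: card_insert_if)
  finally show ?thesis .
qed

text \<open>A second-moment argument. The distance to \<open>A\<close> changes by at most 1 when one
  coordinate changes, so its variance is at most \<open>card I\<close>. It vanishes on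
  \<open>A\<close> and is at least \<open>r\<close> on the far set, so a large far set would force a
  large variance.\<close>

lemma card_far_from_dense:
  assumes I: "finite I" and B: "finite B" and A: "A \<subseteq> I \<rightarrow>\<^sub>E B" and r: "0 \<le> r"
  shows "real (card A) * real (card {x \<in> I \<rightarrow>\<^sub>E B. \<forall>a\<in>A. r < real (hamming I x a)}) * r\<^sup>2
      \<le> real (card I) * (real (card (I \<rightarrow>\<^sub>E B)))\<^sup>2"
proof (cases "A = {}")
  case False
  define P where "P = I \<rightarrow>\<^sub>E B"
  define F where "F = {x \<in> P. \<forall>a\<in>A. r < real (hamming I x a)}"
  define m where "m x = Min (hamming I x ` A)" for x
  have finP: "finite P"
    unfolding P_def using I B by (simp add: finite_PiE)
  have finA: "finite A" and AP: "A \<subseteq> P"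
    using A finP finite_subset unfolding P_def by auto
  have upd_le: "m (x(i := b)) \<le> m x + 1" for x i b
  proof -
    have "m x \<in> hamming I x ` A"
      unfolding m_def using finA False by (intro Min_in) auto
    then obtain a where a: "a \<in> A" "m x = hamming I x a"
      by auto
    then have "m (x(i := b)) \<le> hamming I (x(i := b)) a"
      unfolding m_def using finA by (intro Min_le) auto
    then show ?thesis
      using hamming_fun_upd_le[OF I, of x i b a] a by simp
  qed
  \<comment> \<open>The lower bound is the upper bound for the update that restores the old value
    \<open>x i\<close>.\<close>
  have "\<bar>real (m (x(i := b))) - real (m x)\<bar> \<le> 1" for x i b
    using upd_le[of x i b] upd_le[of "x(i := b)" i "x i"] by simp
  then have var: "(\<Sum>x\<in>P. \<Sum>y\<in>P. (real (m x) - real (m y))\<^sup>2) \<le> 2 * (real (card I) * (real (card P))\<^sup>2)"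
    using variance_PiE_Lipschitz[OF I B, of "\<lambda>x. real (m x)" 1]
    unfolding sum_sum_diff_squared P_def by simp
  have zero: "m x = 0" if "x \<in> A" for x
  proof -
    have "m x \<le> hamming I x x"
      unfolding m_def using finA that by (intro Min_le) auto
    then show ?thesis
      by (simp add: hamming_def)
  qed
  have far: "r \<le> real (m x)" if "x \<in> F" for x
  proof -
    have "m x \<in> hamming I x ` A"
      unfolding m_def using finA False by (intro Min_in) auto
    then show ?thesis
      using that unfolding F_def by fastforce
  qed
  have half: "real (card A) * real (card F) * r\<^sup>2 = (\<Sum>(x, y)\<in>A \<times> F. r\<^sup>2)"
    "real (card A) * real (card F) * r\<^sup>2 = (\<Sum>(x, y)\<in>F \<times> A. r\<^sup>2)"
    by (simp_all add: card_cartesian_product)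
  \<comment> \<open>Counting the pairs in both orders gives a factor 2, which cancels the one in the
    pairwise form of the variance.\<close>
  have "2 * (real (card A) * real (card F) * r\<^sup>2)
      = (\<Sum>(x, y)\<in>A \<times> F. r\<^sup>2) + (\<Sum>(x, y)\<in>F \<times> A. r\<^sup>2)"
    unfolding half(1)[symmetric] half(2)[symmetric] by simp
  also have "\<dots> \<le> (\<Sum>(x, y)\<in>A \<times> F. (real (m x) - real (m y))\<^sup>2)
      + (\<Sum>(x, y)\<in>F \<times> A. (real (m x) - real (m y))\<^sup>2)"
    using far r by (intro add_mono sum_mono) (auto simp: zero power_mono)
  also have "\<dots> \<le> (\<Sum>(x, y)\<in>P \<times> P. (real (m x) - real (m y))\<^sup>2)"
  proof -
    have disj: "A \<inter> F = {}"
      \<comment> \<open>A point of \<open>A\<close> has distance 0 from itself, so it would need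
        \<open>r < 0\<close> to be far.\<close>
      unfolding F_def using r by (force simp: hamming_def)
    have FP: "F \<subseteq> P"
      unfolding F_def by auto
    have "(\<Sum>(x, y)\<in>A \<times> F. (real (m x) - real (m y))\<^sup>2) + (\<Sum>(x, y)\<in>F \<times> A. (real (m x) - real (m y))\<^sup>2)
        = (\<Sum>(x, y)\<in>A \<times> F \<union> F \<times> A. (real (m x) - real (m y))\<^sup>2)"
      using finP AP FP disj
      by (intro sum.union_disjoint[symmetric]) (auto intro: finite_subset)
    also have "\<dots> \<le> (\<Sum>(x, y)\<in>P \<times> P. (real (m x) - real (m y))\<^sup>2)"
      using finP AP FP by (intro sum_mono2) auto
    finally show ?thesis .
  qed
  also have "\<dots> = (\<Sum>x\<in>P. \<Sum>y\<in>P. (real (m x) - real (m y))\<^sup>2)"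
    by (simp add: sum.cartesian_product)
  finally show ?thesis
    using var unfolding F_def P_def by simp
qed simp

section \<open>Almost rainbow tuples in dense sets\<close>

lemma inj_on_add_mod:
  fixes c q :: nat
  shows "inj_on (\<lambda>k. (c + k) mod q) {..<q}"
proof (rule inj_onI)
  fix k l assume kl: "k \<in> {..<q}" "l \<in> {..<q}" and eq: "(c + k) mod q = (c + l) mod q"
  from eq have "k mod q = l mod q"
    by (metis cong_def cong_add_lcancel_nat)
  with kl show "k = l"
    by simp
qed

text \<open>The translates of a point by the \<open>q\<close> constant vectors are pairwise distinct
  in every coordinate. A union bound gives a point all of whose translates are close to
  \<open>A\<close>; moving each of them into \<open>A\<close> spoils only few coordinates.\<close>

lemma dense_contains_almost_rainbow:
  fixes q :: nat and \<epsilon> :: real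
  assumes q: "0 < q" and \<epsilon>: "0 < \<epsilon>"
  obtains d where "0 < d"
    and "\<And>A. A \<subseteq> {..<d} \<rightarrow>\<^sub>E {..<q} \<Longrightarrow> \<epsilon> * real (q ^ d) \<le> real (card A) \<Longrightarrow>
      \<exists>x. (\<forall>k<q. x k \<in> A) \<and>
        real (card {j \<in> {..<d}. \<not> inj_on (\<lambda>k. x k j) {..<q}}) \<le> \<epsilon> * real d"
proof -
  \<comment> \<open>The cube makes q d < \<epsilon> r^2 hold for the radius r = \<epsilon> d / q
    chosen below; that is what the union bound over \<open>q\<close> translates requires.\<close>
  obtain d where d: "(real q / \<epsilon>) ^ 3 < real d"
    using reals_Archimedean2 by blast
  have d0: "0 < d"
    using d q \<epsilon> by (metis divide_pos_pos less_trans of_nat_0_less_iff zero_less_power)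
  define P where "P = {..<d} \<rightarrow>\<^sub>E {..<q}"
  have cardP: "card P = q ^ d"
    unfolding P_def by (simp add: card_PiE)
  have finP: "finite P"
    unfolding P_def by (simp add: finite_PiE)
  have main: "\<exists>x. (\<forall>k<q. x k \<in> A) \<and>
      real (card {j \<in> {..<d}. \<not> inj_on (\<lambda>k. x k j) {..<q}}) \<le> \<epsilon> * real d"
    if AP: "A \<subseteq> P" and dense: "\<epsilon> * real (q ^ d) \<le> real (card A)" for A
  proof -
    \<comment> \<open>The \<open>q\<close> translates may each spoil \<open>r\<close> coordinates,
      and q r is exactly the allowance \<epsilon> d.\<close>
    define r where "r = \<epsilon> * real d / real q"
    define F where "F = {x \<in> P. \<forall>a\<in>A. r < real (hamming {..<d} x a)}"
    define shift where "shift k x = (\<lambda>j\<in>{..<d}. (k + x j) mod q)" for k and x :: "nat \<Rightarrow> nat"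
    have r0: "0 < r"
      unfolding r_def using \<epsilon> q d0 by simp
    have M0: "0 < real (q ^ d)"
      using q by simp
    have "\<epsilon> * real (q ^ d) * (real (card F) * r\<^sup>2) \<le> real (card A) * (real (card F) * r\<^sup>2)"
      using dense by (intro mult_right_mono) auto
    also have "\<dots> \<le> real d * (real (q ^ d))\<^sup>2"
      using card_far_from_dense[of "{..<d}" "{..<q}" A r] AP r0 cardP
      unfolding F_def P_def by (simp add: mult.assoc)
    finally have "(\<epsilon> * r\<^sup>2 * real (card F)) * real (q ^ d) \<le> (real d * real (q ^ d)) * real (q ^ d)"
      by (simp add: power2_eq_square mult_ac)
    then have F: "\<epsilon> * r\<^sup>2 * real (card F) \<le> real d * real (q ^ d)"
      using M0 by (rule mult_right_le_imp_le)
    have "real q ^ 3 < \<epsilon> ^ 3 * real d"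
      using d \<epsilon> by (simp add: power_divide divide_simps mult.commute)
    then have qr: "real q * real d < \<epsilon> * r\<^sup>2"
      using q d0 unfolding r_def by (simp add: field_simps power2_eq_square power3_eq_cube)
    \<comment> \<open>Otherwise the far set \<open>F\<close> would fill at least a 1/q share of the
      cube, against the bound just obtained. It is then nonempty, which keeps the comparison
      strict.\<close>
    have small: "q * card F < q ^ d"
    proof (rule ccontr)
      assume "\<not> q * card F < q ^ d"
      then have le: "real (q ^ d) \<le> real q * real (card F)"
        by (metis not_less of_nat_le_iff of_nat_mult)
      then have "0 < card F"
        using M0 by (metis le less_le_trans mult_zero_right of_nat_0 not_gr_zero less_irrefl)
      then have "real q * real d * real (card F) < \<epsilon> * r\<^sup>2 * real (card F)"
        using qr by simp
      also have "\<dots> \<le> real d * real (q ^ d)"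
        by (rule F)
      also have "\<dots> \<le> real d * (real q * real (card F))"
        using le by (intro mult_left_mono) auto
      finally show False
        by (simp add: mult_ac)
    qed
    have shiftP: "shift k x \<in> P" for k x
      unfolding shift_def P_def using q by auto
    have inj: "inj_on (shift k) P" for k
    proof (rule inj_onI)
      fix x y assume xy: "x \<in> P" "y \<in> P" and eq: "shift k x = shift k y"
      show "x = y"
      proof (rule PiE_ext[OF xy[unfolded P_def]])
        fix j assume j: "j \<in> {..<d}"
        then have "(k + x j) mod q = (k + y j) mod q"
          using fun_cong[OF eq, of j] by (simp add: shift_def)
        moreover have "x j \<in> {..<q}" "y j \<in> {..<q}"
          using xy j unfolding P_def by auto
        ultimately show "x j = y j"
          using inj_on_add_mod[of k q] by (auto dest: inj_onD)
      qed
    qed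
    \<comment> \<open>The points with some translate far from \<open>A\<close>. Translations are
      injective, so each of the \<open>q\<close> preimages of \<open>F\<close> is no larger than
      \<open>F\<close>.\<close>
    define W where "W = (\<Union>k<q. {x \<in> P. shift k x \<in> F})"
    have "card W \<le> (\<Sum>k<q. card {x \<in> P. shift k x \<in> F})"
      unfolding W_def by (rule card_UN_le) simp
    also have "\<dots> \<le> (\<Sum>k<q. card F)"
    proof (rule sum_mono)
      fix k
      show "card {x \<in> P. shift k x \<in> F} \<le> card F"
        using finP by (intro card_inj_on_le[of "shift k"] inj_on_subset[OF inj]) (auto simp: F_def)
    qed
    also have "\<dots> < card P"
      using small by (simp add: cardP)
    finally have "W \<noteq> P"
      by auto
    then obtain x where x: "x \<in> P" "\<And>k. k < q \<Longrightarrow> shift k x \<notin> F"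
      unfolding W_def by blast
    have "\<exists>a\<in>A. real (hamming {..<d} (shift k x) a) \<le> r" if "k < q" for k
      using x(2)[OF that] shiftP unfolding F_def by (auto simp: not_less)
    then obtain y where y: "\<And>k. k < q \<Longrightarrow> y k \<in> A"
      "\<And>k. k < q \<Longrightarrow> real (hamming {..<d} (shift k x) (y k)) \<le> r"
      by metis
    \<comment> \<open>At a coordinate where every \<open>y k\<close> agrees with its translate, the
      values are \<open>x j + k\<close> modulo \<open>q\<close>, which are distinct.\<close>
    have "{j \<in> {..<d}. \<not> inj_on (\<lambda>k. y k j) {..<q}} \<subseteq> (\<Union>k<q. {j \<in> {..<d}. shift k x j \<noteq> y k j})"
    proof (rule subsetI, rule ccontr)
      fix j assume j: "j \<in> {j \<in> {..<d}. \<not> inj_on (\<lambda>k. y k j) {..<q}}"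
        and "j \<notin> (\<Union>k<q. {j \<in> {..<d}. shift k x j \<noteq> y k j})"
      then have "y k j = (x j + k) mod q" if "k \<in> {..<q}" for k
        using that by (auto simp: shift_def add.commute)
      then have "inj_on (\<lambda>k. y k j) {..<q} = inj_on (\<lambda>k. (x j + k) mod q) {..<q}"
        by (intro inj_on_cong) auto
      then show False
        using j inj_on_add_mod by blast
    qed
    then have "card {j \<in> {..<d}. \<not> inj_on (\<lambda>k. y k j) {..<q}}
        \<le> card (\<Union>k<q. {j \<in> {..<d}. shift k x j \<noteq> y k j})"
      by (intro card_mono) auto
    also have "\<dots> \<le> (\<Sum>k<q. hamming {..<d} (shift k x) (y k))"
      unfolding hamming_def by (rule card_UN_le) simp
    finally have "real (card {j \<in> {..<d}. \<not> inj_on (\<lambda>k. y k j) {..<q}})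
        \<le> (\<Sum>k<q. real (hamming {..<d} (shift k x) (y k)))"
      unfolding of_nat_sum[symmetric] of_nat_le_iff .
    also have "\<dots> \<le> (\<Sum>k<q. r)"
      using y by (intro sum_mono) auto
    also have "\<dots> = \<epsilon> * real d"
      using q by (simp add: r_def)
    finally show ?thesis
      using y by blast
  qed
  show thesis
    using that[OF d0] main unfolding P_def by blast
qed

section \<open>Blow-up and the base colouring\<close>

text \<open>A vertex is determined by its label \<open>h (v mod N)\<close> and its quotient
  \<open>v div N\<close>, and below \<open>n\<close> the quotient takes at most n/N + 1
  values.\<close>

lemma card_blow_up_le:
  fixes N n :: nat
  assumes h: "inj_on h {..<N}" and N: "0 < N" and Y: "finite Y"
    and Z: "\<And>v. v \<in> Z \<Longrightarrow> v < n \<and> h (v mod N) \<in> Y"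
  shows "real (card Z) * real N \<le> real (card Y) * (real n + real N)"
proof -
  have "inj_on (\<lambda>v. (h (v mod N), v div N)) Z"
  proof (rule inj_onI)
    fix v w assume "(h (v mod N), v div N) = (h (w mod N), w div N)"
    moreover have "v mod N \<in> {..<N}" "w mod N \<in> {..<N}"
      using N by auto
    ultimately have "v mod N = w mod N" "v div N = w div N"
      using h by (auto dest: inj_onD)
    then show "v = w"
      by (metis div_mult_mod_eq)
  qed
  moreover have "(\<lambda>v. (h (v mod N), v div N)) ` Z \<subseteq> Y \<times> {..n div N}"
  proof (rule image_subsetI)
    fix v assume "v \<in> Z"
    then show "(h (v mod N), v div N) \<in> Y \<times> {..n div N}"
      using Z[of v] div_le_mono[of v n N] by simp
  qed
  ultimately have "card Z \<le> card (Y \<times> {..n div N})"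
    using Y by (intro card_inj_on_le) auto
  then have "card Z * N \<le> card Y * (n div N + 1) * N"
    by (simp add: card_cartesian_product)
  also have "\<dots> \<le> card Y * (n + N)"
    by (simp add: algebra_simps)
  finally show ?thesis
    by (metis of_nat_add of_nat_le_iff of_nat_mult)
qed

text \<open>\<open>f\<close> is the base colour. Whether \<open>v\<close> sees \<open>S\<close> in
  distinct colours is governed by the slice of \<open>v\<close> alone, since its point only
  contributes a common summand. Hence few bad coordinates give few bad slices, and these few bad
  vertices.\<close>

lemma symmetric_colouring_almost_injective:
  fixes q :: nat and \<epsilon> :: real
  assumes q: "0 < q" and \<epsilon>: "0 < \<epsilon>"
  shows "\<forall>\<^sub>F n in sequentially. \<exists>f :: nat \<Rightarrow> nat \<Rightarrow> nat.
    (\<forall>u v. f u v = f v u) \<and> (\<forall>u v. f u v < q) \<and>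
    (\<forall>U \<subseteq> {..<n}. \<epsilon> * real n \<le> real (card U) \<longrightarrow>
      (\<exists>S \<subseteq> U. card S = q \<and>
        real (card {v \<in> {..<n}. \<not> inj_on (\<lambda>u. f u v) S}) < \<epsilon> * real n))"
proof -
  \<comment> \<open>The half of \<epsilon> absorbs the factor 2 lost in the blow-up, and \<delta> <
    1 guarantees that some coordinate is good.\<close>
  define \<delta> where "\<delta> = min (\<epsilon> / 2) (1 / 2)"
  have \<delta>: "0 < \<delta>" "\<delta> < 1" "2 * \<delta> \<le> \<epsilon>"
    using \<epsilon> by (auto simp: \<delta>_def min_def)
  obtain d where d: "0 < d"
    and rainbow: "\<And>A. A \<subseteq> {..<d} \<rightarrow>\<^sub>E {..<q} \<Longrightarrow> \<delta> * real (q ^ d) \<le> real (card A) \<Longrightarrow>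
      \<exists>x. (\<forall>k<q. x k \<in> A) \<and>
        real (card {j \<in> {..<d}. \<not> inj_on (\<lambda>k. x k j) {..<q}}) \<le> \<delta> * real d"
    using dense_contains_almost_rainbow[OF q \<delta>(1)] by blast
  define P where "P = {..<d} \<rightarrow>\<^sub>E {..<q}"
  define N where "N = q ^ d * d"
  have finP: "finite P"
    unfolding P_def by (simp add: finite_PiE)
  have cardP: "card P = q ^ d"
    unfolding P_def by (simp add: card_PiE)
  have N0: "0 < N"
    using q d by (simp add: N_def)
  have "\<exists>h. bij_betw h {..<N} (P \<times> {..<d})"
    using finP ex_bij_betw_nat_finite[of "P \<times> {..<d}"]
    by (simp add: card_cartesian_product cardP N_def atLeast0LessThan)
  then obtain h where h: "bij_betw h {..<N} (P \<times> {..<d})"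
    by blast
  have inj_h: "inj_on h {..<N}"
    using h by (rule bij_betw_imp_inj_on)
  \<comment> \<open>Every vertex inherits the label of its residue class: the point
    \<open>a v\<close> of the cube and the slice \<open>s v\<close>.\<close>
  define a where "a v = fst (h (v mod N))" for v
  define s where "s v = snd (h (v mod N))" for v
  have as: "h (v mod N) = (a v, s v)" "a v \<in> P" "s v < d" for v
    using bij_betwE[OF h] N0 by (auto simp: a_def s_def dest!: bspec[of _ _ "v mod N"])
  define f where "f u v = (a u ((s u + s v) mod d) + a v ((s u + s v) mod d)) mod q" for u v
  have "\<exists>S \<subseteq> U. card S = q \<and> real (card {v \<in> {..<n}. \<not> inj_on (\<lambda>u. f u v) S}) < \<epsilon> * real n"
    if n: "N < n" and U: "U \<subseteq> {..<n}" and dense: "\<epsilon> * real n \<le> real (card U)" for n U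
  proof -
    have NN: "real N = real d * real (q ^ d)"
      by (simp add: N_def)
    \<comment> \<open>A label set of density at most \<delta> carries fewer than \<epsilon> n
      vertices, because n + N < 2 n. It serves twice: to find a dense slice, and to bound the bad
      vertices.\<close>
    have few: "real (card Z) < \<epsilon> * real n"
      if "\<And>v. v \<in> Z \<Longrightarrow> v < n \<and> h (v mod N) \<in> Y" "finite Y" "real (card Y) \<le> \<delta> * real N" for Z Y
    proof -
      have "real (card Z) * real N \<le> real (card Y) * (real n + real N)"
        using that by (intro card_blow_up_le[OF inj_h N0])
      also have "\<dots> \<le> \<delta> * real N * (real n + real N)"
        using that by (intro mult_right_mono) auto
      also have "\<dots> < \<delta> * real N * (2 * real n)"
        using \<delta> N0 n by (intro mult_strict_left_mono) auto
      also have "\<dots> = (2 * \<delta>) * (real n * real N)"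
        by simp
      also have "\<dots> \<le> \<epsilon> * (real n * real N)"
        using \<delta> by (intro mult_right_mono) auto
      finally show ?thesis
        using N0 by simp
    qed
    define A where "A t = a ` {u \<in> U. s u = t}" for t
    have finU: "finite U"
      using U finite_subset by auto
    \<comment> \<open>Pigeonhole: if every slice of the labels of \<open>U\<close> were sparse,
      \<open>U\<close> would have too few labels to be dense.\<close>
    obtain t where t: "t < d" "\<delta> * real (q ^ d) \<le> real (card (A t))"
    proof (rule ccontr)
      assume "\<not> thesis"
      then have lt: "real (card (A t)) \<le> \<delta> * real (q ^ d)" if "t < d" for t
        using that \<open>\<And>t. t < d \<Longrightarrow> \<delta> * real (q ^ d) \<le> real (card (A t)) \<Longrightarrow> thesis\<close> by fastforce
      define Y where "Y = (\<lambda>u. (s u, a u)) ` U"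
      have "Y \<subseteq> Sigma {..<d} A"
        unfolding Y_def A_def using as by auto
      then have "card Y \<le> card (Sigma {..<d} A)"
        using finU by (intro card_mono finite_SigmaI) (auto simp: A_def)
      also have "\<dots> = (\<Sum>t<d. card (A t))"
        using finU by (intro card_SigmaI) (auto simp: A_def)
      finally have "real (card Y) \<le> (\<Sum>t<d. real (card (A t)))"
        by (metis of_nat_le_iff of_nat_sum)
      also have "\<dots> \<le> (\<Sum>t<d. \<delta> * real (q ^ d))"
        using lt by (intro sum_mono) auto
      also have "\<dots> = \<delta> * real N"
        by (simp add: NN)
      finally have Y: "real (card Y) \<le> \<delta> * real N" .
      \<comment> \<open>The pairs in \<open>Y\<close> have the slice first, to fit
        \<open>Sigma\<close>; the labels given by \<open>h\<close> have the point first.\<close>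
      have "real (card (prod.swap ` Y)) \<le> \<delta> * real N"
        using Y by (simp add: card_image)
      then have "real (card U) < \<epsilon> * real n"
        using U finU by (intro few[of U "prod.swap ` Y"]) (auto simp: Y_def as)
      with dense show False
        by simp
    qed
    have "A t \<subseteq> {..<d} \<rightarrow>\<^sub>E {..<q}"
      using as unfolding A_def P_def by auto
    then obtain x where x: "\<And>k. k < q \<Longrightarrow> x k \<in> A t"
      and J: "real (card {j \<in> {..<d}. \<not> inj_on (\<lambda>k. x k j) {..<q}}) \<le> \<delta> * real d"
      using rainbow t by meson
    define J where "J = {j \<in> {..<d}. \<not> inj_on (\<lambda>k. x k j) {..<q}}"
    have "\<forall>k<q. \<exists>u\<in>U. s u = t \<and> a u = x k"
      using x unfolding A_def by force
    then obtain w where w: "\<And>k. k < q \<Longrightarrow> w k \<in> U" "\<And>k. k < q \<Longrightarrow> s (w k) = t"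
      "\<And>k. k < q \<Longrightarrow> a (w k) = x k"
      by metis
    \<comment> \<open>A single good coordinate makes the \<open>x k\<close> distinct, so the
      vertices \<open>w k\<close> above them are distinct and form a set of size
      \<open>q\<close>.\<close>
    have "real (card J) < real d"
      using J \<delta> d unfolding J_def by (smt (verit) mult_less_cancel_right2 of_nat_0_less_iff)
    then have "J \<noteq> {..<d}"
      by auto
    then obtain j where j: "inj_on (\<lambda>k. x k j) {..<q}"
      unfolding J_def by auto
    have inj_w: "inj_on w {..<q}"
    proof (rule inj_onI)
      fix k l assume "k \<in> {..<q}" "l \<in> {..<q}" "w k = w l"
      then show "k = l"
        using w(3)[of k] w(3)[of l] inj_onD[OF j, of k l] by simp
    qed
    have good: "inj_on (\<lambda>u. f u v) (w ` {..<q})" if "(t + s v) mod d \<notin> J" for v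
    proof -
      define i where "i = (t + s v) mod d"
      have i: "i < d" "inj_on (\<lambda>k. x k i) {..<q}"
        using that d unfolding J_def i_def by auto
      have "k = l" if kl: "k < q" "l < q" and eq: "f (w k) v = f (w l) v" for k l
      proof -
        have "(a v i + x k i) mod q = (a v i + x l i) mod q"
          using eq kl w by (simp add: f_def i_def add.commute)
        moreover have "x k i \<in> {..<q}" "x l i \<in> {..<q}"
          using x kl i(1) \<open>A t \<subseteq> {..<d} \<rightarrow>\<^sub>E {..<q}\<close> by blast+
        ultimately have "x k i = x l i"
          using inj_on_add_mod by (auto dest: inj_onD)
        then show ?thesis
          using i(2) kl by (auto dest: inj_onD)
      qed
      then show ?thesis
        by (auto intro!: inj_onI)
    qed
    \<comment> \<open>The slices of \<open>v\<close> that lead to a bad coordinate when paired with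
      slice \<open>t\<close>. Adding \<open>t\<close> modulo \<open>d\<close> is injective, so there
      are at most \<open>card J\<close> of them, and all bad labels lie in
      \<open>P \<times> K\<close>.\<close>
    define K where "K = {l \<in> {..<d}. (t + l) mod d \<in> J}"
    have "card K \<le> card J"
      by (rule card_inj_on_le[of "\<lambda>l. (t + l) mod d"])
        (auto simp: K_def J_def intro: inj_on_subset[OF inj_on_add_mod])
    then have "real (card (P \<times> K)) \<le> real (q ^ d) * real (card J)"
      by (simp add: card_cartesian_product cardP mult_left_mono)
    also have "\<dots> \<le> real (q ^ d) * (\<delta> * real d)"
      using J unfolding J_def by (intro mult_left_mono) auto
    finally have PK: "real (card (P \<times> K)) \<le> \<delta> * real N"
      by (simp add: N_def mult_ac)
    have "real (card {v \<in> {..<n}. \<not> inj_on (\<lambda>u. f u v) (w ` {..<q})}) < \<epsilon> * real n"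
      using PK finP good by (intro few[of _ "P \<times> K"]) (auto simp: as K_def)
    moreover have "w ` {..<q} \<subseteq> U" "card (w ` {..<q}) = q"
      using w inj_w by (auto simp: card_image)
    ultimately show ?thesis
      by blast
  qed
  moreover have "f u v = f v u" "f u v < q" for u v
    using q by (simp_all add: f_def add.commute)
  ultimately have "N < n \<Longrightarrow> \<exists>f :: nat \<Rightarrow> nat \<Rightarrow> nat.
    (\<forall>u v. f u v = f v u) \<and> (\<forall>u v. f u v < q) \<and>
    (\<forall>U \<subseteq> {..<n}. \<epsilon> * real n \<le> real (card U) \<longrightarrow>
      (\<exists>S \<subseteq> U. card S = q \<and>
        real (card {v \<in> {..<n}. \<not> inj_on (\<lambda>u. f u v) S}) < \<epsilon> * real n))" for n
    by blast
  then show ?thesis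
    by (rule eventually_mono[OF eventually_gt_at_top[of N]])
qed

section \<open>Cyclic intervals of colours and the conclusion\<close>

text \<open>With offsets from the start, both the size of an interval and the number of intervals
  through a colour reduce to injectivity of addition modulo \<open>q\<close>.\<close>

definition arc :: "nat \<Rightarrow> nat \<Rightarrow> nat \<Rightarrow> nat set" where
  "arc q p r = (\<lambda>k. (r + k) mod q) ` {..<p}"

lemma arc_subset: "0 < q \<Longrightarrow> arc q p r \<subseteq> {..<q}"
  by (auto simp: arc_def)

lemma card_arc: "p < q \<Longrightarrow> card (arc q p r) = p"
  unfolding arc_def by (subst card_image) (auto intro: inj_on_subset[OF inj_on_add_mod])

text \<open>Each of the \<open>p\<close> offsets at which \<open>c\<close> may occur determines the
  start of the interval.\<close>

lemma card_arcs_containing: "card {r \<in> {..<q}. c \<in> arc q p r} \<le> p"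
proof -
  have "{r \<in> {..<q}. c \<in> arc q p r} \<subseteq> (\<Union>k<p. {r \<in> {..<q}. (k + r) mod q = c})"
    by (auto simp: arc_def add.commute)
  then have "card {r \<in> {..<q}. c \<in> arc q p r} \<le> card (\<Union>k<p. {r \<in> {..<q}. (k + r) mod q = c})"
    by (intro card_mono) auto
  also have "\<dots> \<le> (\<Sum>k<p. card {r \<in> {..<q}. (k + r) mod q = c})"
    by (rule card_UN_le) simp
  also have "\<dots> \<le> (\<Sum>k<p. card {c})"
    by (intro sum_mono card_inj_on_le[of "\<lambda>r. (k + r) mod q" for k])
      (auto intro: inj_on_subset[OF inj_on_add_mod])
  finally show ?thesis
    by simp
qed

theorem theorem1p4:
  fixes p q :: nat and \<epsilon> :: real
  assumes "0 < p" and "p < q" and "0 < \<epsilon>"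
  shows "\<forall>\<^sub>F n in sequentially.
    \<exists>\<phi>. set_coloring q p (complete_graph n) \<phi> \<and>
      (\<forall>G. is_subgraph G (complete_graph n) \<and> monochromatic_graph \<phi> G \<longrightarrow>
        \<not> (\<exists>U \<subseteq> verts G. real (card U) \<ge> \<epsilon> * real n \<and>
             (\<forall>S \<subseteq> U. card S = q \<longrightarrow>
               (\<exists>T \<subseteq> S. card T = p + 1 \<and>
                  real (card (common_neighbors G T)) \<ge> \<epsilon> * real n))))"
proof -
  have q: "0 < q"
    using assms by simp
  show ?thesis
    using symmetric_colouring_almost_injective[OF q assms(3)]
  proof (rule eventually_mono)
    fix n
    assume "\<exists>f :: nat \<Rightarrow> nat \<Rightarrow> nat. (\<forall>u v. f u v = f v u) \<and> (\<forall>u v. f u v < q) \<and>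
      (\<forall>U \<subseteq> {..<n}. \<epsilon> * real n \<le> real (card U) \<longrightarrow>
        (\<exists>S \<subseteq> U. card S = q \<and> real (card {v \<in> {..<n}. \<not> inj_on (\<lambda>u. f u v) S}) < \<epsilon> * real n))"
    then obtain f :: "nat \<Rightarrow> nat \<Rightarrow> nat" where sym: "\<And>u v. f u v = f v u" and f: "\<And>u v. f u v < q"
      and rainbow: "\<And>U. U \<subseteq> {..<n} \<Longrightarrow> \<epsilon> * real n \<le> real (card U) \<Longrightarrow>
        \<exists>S \<subseteq> U. card S = q \<and> real (card {v \<in> {..<n}. \<not> inj_on (\<lambda>u. f u v) S}) < \<epsilon> * real n"
      by blast
    \<comment> \<open>\<open>Min\<close> and \<open>Max\<close> recover the ends of an edge in some
      order; the symmetry of \<open>f\<close> makes the order irrelevant.\<close>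
    define \<phi> where "\<phi> e = arc q p (f (Min e) (Max e))" for e
    have \<phi>: "\<phi> {u, v} = arc q p (f u v)" for u v
      using sym[of u v] by (simp add: \<phi>_def min_def max_def)
    have False if G: "is_subgraph G (complete_graph n)" "monochromatic_graph \<phi> G"
      and U: "U \<subseteq> verts G" "\<epsilon> * real n \<le> real (card U)"
      and common: "\<And>S. S \<subseteq> U \<Longrightarrow> card S = q \<Longrightarrow>
        \<exists>T \<subseteq> S. card T = p + 1 \<and> \<epsilon> * real n \<le> real (card (common_neighbors G T))" for G U
    proof -
      have V: "verts G \<subseteq> {..<n}"
        using G(1) by (simp add: is_subgraph_def complete_graph_def verts_def)
      obtain c where c: "\<And>e. e \<in> edges G \<Longrightarrow> c \<in> \<phi> e"
        using G(2) unfolding monochromatic_graph_def by blast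
      obtain S where S: "S \<subseteq> U" "card S = q"
        and bad: "real (card {v \<in> {..<n}. \<not> inj_on (\<lambda>u. f u v) S}) < \<epsilon> * real n"
        using rainbow[of U] U V by blast
      obtain T where T: "T \<subseteq> S" "card T = p + 1" "\<epsilon> * real n \<le> real (card (common_neighbors G T))"
        using common[OF S] by blast
      have "common_neighbors G T \<subseteq> {v \<in> {..<n}. \<not> inj_on (\<lambda>u. f u v) S}"
      proof
        fix v assume "v \<in> common_neighbors G T"
        then have v: "v < n" "\<And>u. u \<in> T \<Longrightarrow> {u, v} \<in> edges G"
          using V by (auto simp: common_neighbors_def)
        have "\<not> inj_on (\<lambda>u. f u v) S"
        proof
          assume "inj_on (\<lambda>u. f u v) S"
          \<comment> \<open>Every edge from \<open>T\<close> to \<open>v\<close> carries the common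
            colour \<open>c\<close>, so injectivity would give p + 1 different starts of intervals
            containing \<open>c\<close>.\<close>
          then have "card T \<le> card {r \<in> {..<q}. c \<in> arc q p r}"
            using c v f T(1)
            by (intro card_inj_on_le[of "\<lambda>u. f u v"]) (auto simp: \<phi>[symmetric] intro: inj_on_subset)
          then show False
            using card_arcs_containing[of q c p] T(2) by simp
        qed
        then show "v \<in> {v \<in> {..<n}. \<not> inj_on (\<lambda>u. f u v) S}"
          using v by simp
      qed
      then have "card (common_neighbors G T) \<le> card {v \<in> {..<n}. \<not> inj_on (\<lambda>u. f u v) S}"
        by (intro card_mono) auto
      then show False
        using bad T(3) by linarith
    qed
    moreover have "set_coloring q p (complete_graph n) \<phi>"
      using assms(2) q arc_subset card_arc by (auto simp: set_coloring_def \<phi>_def)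
    ultimately show "\<exists>\<phi>. set_coloring q p (complete_graph n) \<phi> \<and>
      (\<forall>G. is_subgraph G (complete_graph n) \<and> monochromatic_graph \<phi> G \<longrightarrow>
        \<not> (\<exists>U \<subseteq> verts G. real (card U) \<ge> \<epsilon> * real n \<and>
             (\<forall>S \<subseteq> U. card S = q \<longrightarrow>
               (\<exists>T \<subseteq> S. card T = p + 1 \<and>
                  real (card (common_neighbors G T)) \<ge> \<epsilon> * real n))))"
      by meson
  qed
qed

end
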